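(* Let $t\ge 2$ and let $\boldsymbol{R}$ be a symmetric cycle in the hypercube graph $\boldsymbol{H}(t,2)$. (i) We have $$\sum_{T\in\{1,-1\}^t}|\boldsymbol{Q}(T,\boldsymbol{R})|=\frac t2\sum_{\substack{1\le i\le t;\\ j\in\{i-2,\,i+2\}:\ 0\le j\le t}}\mathtt{p}_{ij}^2\,i(i-j)=\frac t2\sum_{\substack{1\le i\le t;\\ j\in\{i-2,\,i+2\}:\ 0\le j\le t}}\binom{t-2}{\frac{i+j}{2}-1}i(i-j),$$ that is, $$\sum_{T\in\{1,-1\}^t}|\boldsymbol{Q}(T,\boldsymbol{R})|=2^{t-1}t,$$ the number of edges in $\boldsymbol{H}(t,2)$. (ii) We have $$\sum_{T\in\{1,-1\}^t}\ \sum_{Q\in\boldsymbol{Q}(T,\boldsymbol{R})}d(T,Q)=2^{t-2}(t-2)t.$$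
   Context: The hypercube graph $\boldsymbol{H}(t,2)$ has vertex set $\{1,-1\}^t$, regarded as row vectors in $\mathbb{R}^t$; two vertices are adjacent iff they differ in exactly one component. The graph distance $d(\cdot,\cdot)$ is the Hamming distance. A symmetric cycle in $\boldsymbol{H}(t,2)$ is a cycle $\boldsymbol{R}=(R^0,R^1,\ldots,R^{2t-1},R^0)$ of length $2t$ in this graph (with $2t$ distinct vertices) such that $R^{k+t}=-R^k$ for $0\le k\le t-1$. It is known that for every $T\in\{1,-1\}^t$ there is a unique inclusion-minimal subset of $\{R^0,\ldots,R^{2t-1}\}$ whose elements sum (in $\mathbb{R}^t$) to $T$; this subset is denoted $\boldsymbol{Q}(T,\boldsymbol{R})$. The intersection number $\mathtt{p}_{ij}^2$ (the superscript $2$ is an index, not an exponent) of the Hamming association scheme $\mathbf{H}(t,2)$ is $\mathtt{p}_{ij}^2:=|\{Z\in\{1,-1\}^t:\ d(Z,X)=i,\ d(Z,Y)=j\}|$, where $X,Y\in\{1,-1\}^t$ are any two vertices with $d(X,Y)=2$ (the value does not depend on the choice of $X,Y$). *)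

theory Defs
  imports "HOL-Analysis.Analysis"
begin

text \<open>The dimension \<open>t\<close> is \<open>CARD('n)\<close>.\<close>

definition hypercube :: "(real ^ 'n) set" where
  "hypercube = {X. \<forall>i. X $ i \<in> {1, -1}}"

definition hdist :: "real ^ 'n \<Rightarrow> real ^ 'n \<Rightarrow> nat" where
  "hdist X Y = card {i. X $ i \<noteq> Y $ i}"

definition hypercube_adj :: "real ^ 'n \<Rightarrow> real ^ 'n \<Rightarrow> bool" where
  "hypercube_adj X Y \<longleftrightarrow> X \<in> hypercube \<and> Y \<in> hypercube \<and> hdist X Y = 1"

definition hypercube_edges :: "(real ^ 'n) set set" where
  "hypercube_edges = {{X, Y} | X Y. hypercube_adj X Y}"

text \<open>Only the values \<open>R 0, \<dots>, R (2 * t - 1)\<close> are relevant; the cycle is closed by the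
  edge from \<open>R (2 * t - 1)\<close> to \<open>R 0\<close>.\<close>

definition symmetric_cycle :: "(nat \<Rightarrow> real ^ 'n) \<Rightarrow> bool" where
  "symmetric_cycle R \<longleftrightarrow>
     inj_on R {..<2 * CARD('n)} \<and>
     (\<forall>k<2 * CARD('n). hypercube_adj (R k) (R (Suc k mod (2 * CARD('n))))) \<and>
     (\<forall>k<CARD('n). R (k + CARD('n)) = - R k)"

definition cycle_vertices :: "(nat \<Rightarrow> real ^ 'n) \<Rightarrow> (real ^ 'n) set" where
  "cycle_vertices R = R ` {..<2 * CARD('n)}"

text \<open>The unique inclusion-minimal set of cycle vertices whose sum is \<open>T\<close>.\<close>

definition min_decomp :: "real ^ 'n \<Rightarrow> (nat \<Rightarrow> real ^ 'n) \<Rightarrow> (real ^ 'n) set" where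
  "min_decomp T R = (THE Q. Q \<subseteq> cycle_vertices R \<and> \<Sum>Q = T \<and> (\<forall>S. S \<subset> Q \<longrightarrow> \<Sum>S \<noteq> T))"

text \<open>The intersection number with upper index \<open>l\<close> and lower indices \<open>i\<close>, \<open>j\<close> of the Hamming
  scheme of dimension \<open>CARD('n)\<close>, meaningful for \<open>l \<le> CARD('n)\<close>: the common value of the
  cardinality below over all pairs of vertices at distance \<open>l\<close>.\<close>

definition intersection_number :: "'n::finite itself \<Rightarrow> nat \<Rightarrow> nat \<Rightarrow> nat \<Rightarrow> nat" where
  "intersection_number _ l i j = (THE m. \<forall>X \<in> hypercube. \<forall>Y \<in> hypercube.
     hdist X Y = l \<longrightarrow> card {Z :: real ^ 'n. Z \<in> hypercube \<and> hdist Z X = i \<and> hdist Z Y = j} = m)"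

end

theory Submission
  imports Defs
begin

text \<open>
  Let the cycle flip coordinate \<open>e k\<close> on its way from \<open>R k\<close> to \<open>R (k + 1)\<close>, for \<open>k < t\<close>. Each coordinate
  occurs exactly once as an \<open>e k\<close>, and the functionals
  \<open>c k V = (V $ e k * R k $ e k + V $ e (k - 1) * R k $ e (k - 1)) / 2\<close>, with indices read cyclically,
  form the basis dual to \<open>R 0, \<dots>, R (t - 1)\<close>. On a hypercube vertex \<open>T\<close> they only take the values
  \<open>-1, 0, 1\<close>, so the minimal decomposition of \<open>T\<close> consists of the cycle vertices that agree with \<open>T\<close> in
  the two coordinates flipped by their incident cycle edges. Each of the \<open>2 t\<close> cycle vertices thus
  lies in the decompositions of \<open>2 ^ (t - 2)\<close> vertices \<open>T\<close>, at average distance \<open>(t - 2) / 2\<close>.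
\<close>

section \<open>Vertices coded by their sets of sign changes\<close>

definition flips :: "real ^ 'n \<Rightarrow> 'n set \<Rightarrow> real ^ 'n" where
  "flips A S = (\<chi> i. if i \<in> S then - A $ i else A $ i)"

lemma flips_nth [simp]: "flips A S $ i = (if i \<in> S then - A $ i else A $ i)"
  by (simp add: flips_def)

lemma hypercube_nth_cases: "X \<in> hypercube \<Longrightarrow> X $ i = 1 \<or> X $ i = -1"
  by (auto simp: hypercube_def)

lemma hypercube_nth_neq_iff:
  assumes "X \<in> hypercube" "Y \<in> hypercube"
  shows "X $ i \<noteq> Y $ i \<longleftrightarrow> X $ i = - Y $ i"
  using hypercube_nth_cases[OF assms(1), of i] hypercube_nth_cases[OF assms(2), of i] by auto

lemma flips_in_hypercube: "A \<in> hypercube \<Longrightarrow> flips A S \<in> hypercube"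
  by (auto simp: hypercube_def)

lemma hdist_commute: "hdist X Y = hdist Y X"
  by (simp add: hdist_def eq_commute)

lemma flips_differing_set:
  assumes "A \<in> hypercube"
  shows "{i. flips A S $ i \<noteq> A $ i} = S"
proof -
  have "A $ i \<noteq> 0" for i
    using hypercube_nth_cases[OF assms, of i] by auto
  then show ?thesis by auto
qed

lemma flips_differing:
  assumes "A \<in> hypercube" "X \<in> hypercube"
  shows "flips A {i. X $ i \<noteq> A $ i} = X"
  unfolding vec_eq_iff
proof
  fix i
  show "flips A {i. X $ i \<noteq> A $ i} $ i = X $ i"
    using hypercube_nth_neq_iff[OF assms(2,1), of i] by (cases "X $ i = A $ i") simp_all
qed

text \<open>Entries of a vertex are nonzero with only two possible values, so relative to a base
  vertex \<open>A\<close> a vertex and its set of differing coordinates determine each other. All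
  later counts of vertices become counts of subsets through this bijection.\<close>

lemma bij_betw_flips:
  assumes "A \<in> hypercube"
  shows "bij_betw (flips A) {S. P S} {X \<in> hypercube. P {i. X $ i \<noteq> A $ i}}"
proof (rule bij_betw_byWitness[where f' = "\<lambda>X. {i. X $ i \<noteq> A $ i}"])
  show "\<forall>S\<in>{S. P S}. {i. flips A S $ i \<noteq> A $ i} = S"
    using flips_differing_set[OF assms] by blast
  show "\<forall>X\<in>{X \<in> hypercube. P {i. X $ i \<noteq> A $ i}}. flips A {i. X $ i \<noteq> A $ i} = X"
    using flips_differing[OF assms] by blast
  show "flips A ` {S. P S} \<subseteq> {X \<in> hypercube. P {i. X $ i \<noteq> A $ i}}"
  proof clarify
    fix S assume "P S"
    then show "flips A S \<in> hypercube \<and> P {i. flips A S $ i \<noteq> A $ i}"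
      using flips_in_hypercube[OF assms] by (simp only: flips_differing_set[OF assms])
  qed
  show "(\<lambda>X. {i. X $ i \<noteq> A $ i}) ` {X \<in> hypercube. P {i. X $ i \<noteq> A $ i}} \<subseteq> {S. P S}"
    by blast
qed

lemma inj_flips: "A \<in> hypercube \<Longrightarrow> inj (flips A)"
  by (rule inj_on_inverseI, rule flips_differing_set)

lemma hdist_flips: "A \<in> hypercube \<Longrightarrow> hdist (flips A S) A = card S"
  unfolding hdist_def by (simp only: flips_differing_set)

lemma hypercube_eq_range_flips: "A \<in> hypercube \<Longrightarrow> hypercube = range (flips A)"
  using bij_betw_flips[of A "\<lambda>_. True"] by (simp add: bij_betw_def)

lemma one_in_hypercube: "1 \<in> hypercube"
  by (simp add: hypercube_def)

lemma finite_hypercube: "finite (hypercube :: (real ^ 'n) set)"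
  unfolding hypercube_eq_range_flips[OF one_in_hypercube] by simp

section \<open>Counting in subcubes and counting edges\<close>

text \<open>Complementation permutes the subsets, and the sizes of a subset and its complement add
  up to \<open>card A\<close>. The factor 2 avoids a division in the naturals.\<close>

lemma sum_card_Pow:
  assumes "finite A"
  shows "2 * (\<Sum>S\<in>Pow A. card S) = card A * 2 ^ card A"
proof -
  have "(\<Sum>S\<in>Pow A. card S) = (\<Sum>S\<in>Pow A. card (A - S))"
    by (rule sum.reindex_bij_witness[where i = "\<lambda>S. A - S" and j = "\<lambda>S. A - S"])
      (auto simp: double_diff)
  then have "2 * (\<Sum>S\<in>Pow A. card S) = (\<Sum>S\<in>Pow A. card S + card (A - S))"
    by (simp add: sum.distrib)
  also have "\<dots> = (\<Sum>S\<in>Pow A. card A)"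
  proof (rule sum.cong[OF refl])
    fix S assume "S \<in> Pow A"
    then show "card S + card (A - S) = card A"
      using assms card_Diff_subset[of S A] card_mono[of A S] finite_subset[of S A] by auto
  qed
  finally show ?thesis
    using assms by (simp add: card_Pow)
qed

lemma card_Compl_finite: "card (- D :: 'n::finite set) = CARD('n) - card D"
  by (simp add: Compl_eq_Diff_UNIV card_Diff_subset)

lemma bij_betw_flips_agreeing:
  assumes "v \<in> hypercube"
  shows "bij_betw (flips v) (Pow (- D)) {T \<in> hypercube. \<forall>i\<in>D. T $ i = v $ i}"
proof -
  have "{S. S \<subseteq> - D} = Pow (- D)" by auto
  moreover have "{X \<in> hypercube. {i. X $ i \<noteq> v $ i} \<subseteq> - D} = {T \<in> hypercube. \<forall>i\<in>D. T $ i = v $ i}"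
    by auto
  ultimately show ?thesis
    using bij_betw_flips[OF assms, of "\<lambda>S. S \<subseteq> - D"] by simp
qed

lemma card_hypercube_agreeing:
  fixes v :: "real ^ 'n"
  assumes "v \<in> hypercube"
  shows "card {T \<in> hypercube. \<forall>i\<in>D. T $ i = v $ i} = 2 ^ (CARD('n) - card D)"
  using bij_betw_same_card[OF bij_betw_flips_agreeing[OF assms, of D]]
  by (simp add: card_Pow card_Compl_finite)

text \<open>Vertices agreeing with \<open>v\<close> on \<open>D\<close> arise by flipping subsets of
  \<open>- D\<close>, and the distance to \<open>v\<close> is the size of the flipped
  subset.\<close>

lemma sum_hdist_agreeing:
  fixes v :: "real ^ 'n"
  assumes "v \<in> hypercube"
  shows "2 * (\<Sum>T | T \<in> hypercube \<and> (\<forall>i\<in>D. T $ i = v $ i). hdist T v) =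
    (CARD('n) - card D) * 2 ^ (CARD('n) - card D)"
proof -
  have "(\<Sum>T | T \<in> hypercube \<and> (\<forall>i\<in>D. T $ i = v $ i). hdist T v) = (\<Sum>S\<in>Pow (- D). card S)"
    using sum.reindex_bij_betw[OF bij_betw_flips_agreeing[OF assms, of D], of "\<lambda>T. hdist T v"]
    by (simp add: hdist_flips[OF assms])
  then show ?thesis
    using sum_card_Pow[of "- D"] by (simp add: card_Compl_finite)
qed

text \<open>An edge is coded by its direction \<open>i\<close> and by the smaller of the flip sets
  of its endpoints relative to the all-ones vertex, which is a subset of \<open>- {i}\<close>. The
  coding is bijective.\<close>

lemma card_hypercube_edges: "card (hypercube_edges :: (real ^ 'n) set set) = 2 ^ (CARD('n) - 1) * CARD('n)"
proof -
  let ?B = "1 :: real ^ 'n"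
  let ?f = "\<lambda>(i :: 'n, S). {flips ?B S, flips ?B (insert i S)}"
  let ?D = "SIGMA i : (UNIV :: 'n set). Pow (- {i})"
  have inj: "inj_on ?f ?D"
  proof (rule inj_onI, clarify)
    fix i i' :: 'n and S S'
    assume S: "S \<subseteq> - {i}" "S' \<subseteq> - {i'}"
      and eq: "{flips ?B S, flips ?B (insert i S)} = {flips ?B S', flips ?B (insert i' S')}"
    have "{S, insert i S} = {S', insert i' S'}"
      using eq inj_image_eq_iff[OF inj_flips[OF one_in_hypercube], of "{S, insert i S}" "{S', insert i' S'}"]
      by simp
    then consider "S = S'" "insert i S = insert i' S'" | "S = insert i' S'" "insert i S = S'"
      by (auto simp: doubleton_eq_iff)
    then show "i = i' \<and> S = S'"
    proof cases
      case 1
      then show ?thesis using S by blast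
    next
      case 2
      \<comment> \<open>Impossible case: \<open>i\<close> would lie in \<open>S'\<close>, hence in
        \<open>S\<close>.\<close>
      then show ?thesis using S by blast
    qed
  qed
  have im: "?f ` ?D = hypercube_edges"
  proof
    show "?f ` ?D \<subseteq> hypercube_edges"
    proof clarify
      fix i :: 'n and S assume "S \<subseteq> - {i}"
      then have "{j. flips ?B S $ j \<noteq> flips ?B (insert i S) $ j} = {i}"
        by auto
      then have "hypercube_adj (flips ?B S) (flips ?B (insert i S))"
        by (simp add: hypercube_adj_def hdist_def flips_in_hypercube one_in_hypercube del: flips_nth)
      then show "{flips ?B S, flips ?B (insert i S)} \<in> hypercube_edges"
        unfolding hypercube_edges_def by blast
    qed
    show "hypercube_edges \<subseteq> ?f ` ?D"
    proof
      fix E :: "(real ^ 'n) set" assume "E \<in> hypercube_edges"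
      then obtain X Y where E: "E = {X, Y}" and h: "X \<in> hypercube" "Y \<in> hypercube" "hdist X Y = 1"
        by (auto simp: hypercube_edges_def hypercube_adj_def)
      from h(3) obtain i where i: "{j. X $ j \<noteq> Y $ j} = {i}"
        by (auto simp: hdist_def card_1_singleton_iff)
      define U V where "U = {j. X $ j \<noteq> ?B $ j}" and "V = {j. Y $ j \<noteq> ?B $ j}"
      have UV: "flips ?B U = X" "flips ?B V = Y"
        unfolding U_def V_def by (simp_all only: flips_differing[OF one_in_hypercube] h)
      have neq: "X $ i = - Y $ i"
        using i hypercube_nth_neq_iff[OF h(1,2)] by blast
      have "j \<in> U \<longleftrightarrow> j \<in> V" if "j \<noteq> i" for j
      proof -
        have "X $ j = Y $ j" using i that by blast
        then show ?thesis by (simp add: U_def V_def)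
      qed
      moreover have "i \<in> U \<longleftrightarrow> i \<notin> V"
        unfolding U_def V_def mem_Collect_eq neq
        using hypercube_nth_cases[OF h(2), of i] by auto
      \<comment> \<open>The flip sets differ in \<open>i\<close> alone, so one is the other with
        \<open>i\<close> added; the smaller one is the code.\<close>
      ultimately have "(i \<notin> U \<and> V = insert i U) \<or> (i \<notin> V \<and> U = insert i V)"
        unfolding set_eq_iff insert_iff by metis
      then have "E = ?f (i, U) \<and> i \<notin> U \<or> E = ?f (i, V) \<and> i \<notin> V"
        unfolding E UV(1)[symmetric] UV(2)[symmetric] by (auto simp: insert_commute)
      then show "E \<in> ?f ` ?D"
        by blast
    qed
  qed
  have "card (hypercube_edges :: (real ^ 'n) set set) = card ?D"
    using card_image[OF inj] im by simp
  also have "\<dots> = 2 ^ (CARD('n) - 1) * CARD('n)"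
    by (simp add: card_Pow card_Compl_finite)
  finally show ?thesis .
qed

section \<open>Intersection numbers of the Hamming scheme\<close>

text \<open>The description by \<open>THE\<close> pins down a value only if some pair of vertices at
  distance \<open>l\<close> exists. The bound on \<open>l\<close> supplies one: the all-ones vertex
  and its flip on \<open>l\<close> coordinates.\<close>

lemma intersection_number_eq:
  assumes "CARD('n::finite) \<ge> l"
    and "\<And>X Y :: real ^ 'n. X \<in> hypercube \<Longrightarrow> Y \<in> hypercube \<Longrightarrow> hdist X Y = l \<Longrightarrow>
      card {Z. Z \<in> hypercube \<and> hdist Z X = i \<and> hdist Z Y = j} = m"
  shows "intersection_number TYPE('n) l i j = m"
proof -
  obtain D :: "'n set" where D: "card D = l"
    using obtain_subset_with_card_n[of l "UNIV :: 'n set"] assms(1) by auto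
  let ?X = "flips 1 D :: real ^ 'n"
  let ?P = "\<lambda>X Y m. card {Z :: real ^ 'n. Z \<in> hypercube \<and> hdist Z X = i \<and> hdist Z Y = j} = m"
  have X: "?X \<in> hypercube" "hdist ?X 1 = l"
    using D by (simp_all add: hdist_flips flips_in_hypercube one_in_hypercube)
  show ?thesis
    unfolding intersection_number_def
  proof (rule the_equality)
    show "\<forall>X \<in> hypercube. \<forall>Y \<in> hypercube. hdist X Y = l \<longrightarrow> ?P X Y m"
      using assms(2) by (intro ballI impI)
    fix m' assume "\<forall>X \<in> hypercube. \<forall>Y \<in> hypercube. hdist X Y = l \<longrightarrow> ?P X Y m'"
    then have "?P ?X 1 m'"
      using X one_in_hypercube by blast
    then show "m' = m"
      using assms(2)[OF X(1) one_in_hypercube X(2)] by simp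
  qed
qed

text \<open>With two possible entries, \<open>Z\<close> differs from \<open>Y\<close> at a
  coordinate iff exactly one of \<open>Z\<close> and \<open>Y\<close> differs from \<open>X\<close>
  there. Coding \<open>Z\<close> by its difference set from \<open>X\<close> thus turns the second
  distance into the size of a symmetric difference.\<close>

lemma card_two_distances:
  fixes X Y :: "real ^ 'n"
  assumes X: "X \<in> hypercube" and Y: "Y \<in> hypercube"
  shows "card {Z. Z \<in> hypercube \<and> hdist Z X = i \<and> hdist Z Y = j} =
    card {S. card S = i \<and> card (sym_diff S {k. Y $ k \<noteq> X $ k}) = j}"
proof -
  let ?D = "{k. Y $ k \<noteq> X $ k}"
  have "{k. Z $ k \<noteq> Y $ k} = sym_diff {k. Z $ k \<noteq> X $ k} ?D" if "Z \<in> hypercube" for Z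
  proof -
    have "Z $ k \<noteq> Y $ k \<longleftrightarrow> (Z $ k \<noteq> X $ k) \<noteq> (Y $ k \<noteq> X $ k)" for k
      using hypercube_nth_cases[OF that, of k] hypercube_nth_cases[OF X, of k]
        hypercube_nth_cases[OF Y, of k] by auto
    then show ?thesis by blast
  qed
  then have "{Z. Z \<in> hypercube \<and> hdist Z X = i \<and> hdist Z Y = j} =
      {Z \<in> hypercube. card {k. Z $ k \<noteq> X $ k} = i \<and> card (sym_diff {k. Z $ k \<noteq> X $ k} ?D) = j}"
    unfolding hdist_def by auto
  then show ?thesis
    using bij_betw_same_card[OF bij_betw_flips[OF X, of "\<lambda>S. card S = i \<and> card (sym_diff S ?D) = j"]]
    by simp
qed

lemma card_sym_diff_eq:
  assumes "finite S" "finite D"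
  shows "card (sym_diff S D) + 2 * card (S \<inter> D) = card S + card D"
proof -
  have "card (sym_diff S D) = card (S - D) + card (D - S)"
    using assms by (intro card_Un_disjoint) auto
  moreover have "card S = card (S - D) + card (S \<inter> D)"
    using card_Int_Diff[OF assms(1), of D] by simp
  moreover have "card D = card (D - S) + card (S \<inter> D)"
    using card_Int_Diff[OF assms(2), of S] by (simp add: Int_commute)
  ultimately show ?thesis by simp
qed

text \<open>The size \<open>i + l\<close> of the symmetric difference is the largest possible and
  forces \<open>S\<close> to be disjoint from \<open>D\<close>, which leaves the
  \<open>i\<close>-subsets of the complement of \<open>D\<close>.\<close>

lemma intersection_number_plus:
  assumes "CARD('n::finite) \<ge> l"
  shows "intersection_number TYPE('n) l i (i + l) = (CARD('n) - l) choose i"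
proof (rule intersection_number_eq[OF assms])
  fix X Y :: "real ^ 'n"
  assume X: "X \<in> hypercube" and Y: "Y \<in> hypercube" and l: "hdist X Y = l"
  define D where "D = {k. Y $ k \<noteq> X $ k}"
  have D: "card D = l"
    using l by (simp add: D_def hdist_def eq_commute)
  have "card S = i \<and> card (sym_diff S D) = i + l \<longleftrightarrow> S \<subseteq> - D \<and> card S = i" for S
  proof -
    have "card (S \<inter> D) = 0 \<longleftrightarrow> S \<subseteq> - D"
      by auto
    then show ?thesis
      using card_sym_diff_eq[of S D] D by auto
  qed
  then show "card {Z. Z \<in> hypercube \<and> hdist Z X = i \<and> hdist Z Y = i + l} = (CARD('n) - l) choose i"
    using card_two_distances[OF X Y] n_subsets[of "- D" i] D
    by (simp add: D_def[symmetric] card_Compl_finite)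
qed

text \<open>Exchanging the roles of \<open>X\<close> and \<open>Y\<close> turns one predicate under
  \<open>THE\<close> into the other.\<close>

lemma intersection_number_sym:
  "intersection_number TYPE('n::finite) l i j = intersection_number TYPE('n) l j i"
proof -
  show ?thesis
    unfolding intersection_number_def
  proof (rule arg_cong[where f = The], rule ext)
    fix m
    let ?P = "\<lambda>i j (X :: real ^ 'n) Y. hdist X Y = l \<longrightarrow>
      card {Z. Z \<in> hypercube \<and> hdist Z X = i \<and> hdist Z Y = j} = m"
    have "?P i j X Y \<longleftrightarrow> ?P j i Y X" for X Y
      by (simp add: hdist_commute[of X Y] conj_commute)
    then show "(\<forall>X\<in>hypercube. \<forall>Y\<in>hypercube. ?P i j X Y) \<longleftrightarrow> (\<forall>X\<in>hypercube. \<forall>Y\<in>hypercube. ?P j i X Y)"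
      by meson
  qed
qed

section \<open>Evaluating the sum over index pairs\<close>

lemma sum_index_pairs:
  fixes f :: "nat \<Rightarrow> nat \<Rightarrow> real"
  assumes "t \<ge> 2"
  shows "(\<Sum>(i, j) | 1 \<le> i \<and> i \<le> t \<and> j \<le> t \<and> int j \<in> {int i - 2, int i + 2}. f i j * real i * (real i - real j))
    = (\<Sum>m\<le>t-2. f (m + 2) m * real (m + 2) * 2) - (\<Sum>m\<le>t-2. f m (m + 2) * real m * 2)"
proof -
  let ?g = "\<lambda>(i, j). f i j * real i * (real i - real j)"
  let ?I = "{(i, j). 1 \<le> i \<and> i \<le> t \<and> j \<le> t \<and> int j \<in> {int i - 2, int i + 2}}"
  let ?A = "(\<lambda>m. (m + 2, m)) ` {..t-2}" and ?B = "(\<lambda>m. (m, m + 2)) ` {..t-2}"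
  have sub: "?I \<subseteq> ?A \<union> ?B"
  proof clarify
    fix i j assume *: "1 \<le> i" "i \<le> t" "j \<le> t" "int j \<in> {int i - 2, int i + 2}" "(i, j) \<notin> ?B"
    then have "i = j + 2 \<or> j = i + 2" by auto
    then show "(i, j) \<in> ?A" using * by auto
  qed
  have "sum ?g ?I = sum ?g (?A \<union> ?B)"
    \<comment> \<open>The only extra pair on the right is \<open>(0, 2)\<close>; its term vanishes
      through the factor \<open>i\<close>.\<close>
    by (rule sum.mono_neutral_left) (use sub assms in auto)
  also have "\<dots> = sum ?g ?A + sum ?g ?B"
    by (rule sum.union_disjoint) auto
  also have "sum ?g ?A = (\<Sum>m\<le>t-2. f (m + 2) m * real (m + 2) * 2)"
    by (subst sum.reindex) (auto simp: inj_on_def)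
  also have "sum ?g ?B = (\<Sum>m\<le>t-2. - (f m (m + 2) * real m * 2))"
    by (subst sum.reindex) (auto simp: inj_on_def intro!: sum.cong)
  finally show ?thesis
    by (simp add: sum_negf)
qed

text \<open>For each \<open>m\<close> the weights \<open>2 * (m + 2)\<close> and
  \<open>- 2 * m\<close> add up to 4, and the binomial row sums to \<open>2 ^ (t - 2)\<close>.
  Keeping \<open>f\<close> abstract serves both the intersection numbers and the explicit
  binomials.\<close>

lemma sum_index_pairs_binomial:
  fixes f :: "nat \<Rightarrow> nat \<Rightarrow> real"
  assumes "t \<ge> 2"
    and "\<And>m. f (m + 2) m = real ((t - 2) choose m)"
    and "\<And>m. f m (m + 2) = real ((t - 2) choose m)"
  shows "(\<Sum>(i, j) | 1 \<le> i \<and> i \<le> t \<and> j \<le> t \<and> int j \<in> {int i - 2, int i + 2}. f i j * real i * (real i - real j))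
    = 2 ^ t"
proof -
  have "(\<Sum>(i, j) | 1 \<le> i \<and> i \<le> t \<and> j \<le> t \<and> int j \<in> {int i - 2, int i + 2}. f i j * real i * (real i - real j))
    = (\<Sum>m\<le>t-2. 4 * real ((t - 2) choose m))"
    unfolding sum_index_pairs[OF assms(1)] assms(2,3)
    by (simp add: sum_subtractf[symmetric] algebra_simps)
  also have "\<dots> = 4 * real (\<Sum>m\<le>t-2. (t - 2) choose m)"
    by (simp add: sum_distrib_left)
  also have "\<dots> = 4 * 2 ^ (t - 2)"
    by (simp only: choose_row_sum) simp
  also have "\<dots> = 2 ^ (2 + (t - 2))"
    by (simp only: power_add) simp
  also have "2 + (t - 2) = t"
    using assms(1) by simp
  finally show ?thesis .
qed

section \<open>Minimality and the order of flips along the cycle\<close>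

text \<open>A least set with sum \<open>T\<close> is the unique minimal one: any competitor contains
  it, and containing it properly would contradict the competitor's minimality.\<close>

lemma min_decomp_eqI:
  assumes "G \<subseteq> cycle_vertices R" "\<Sum>G = T"
    and least: "\<And>S. S \<subseteq> cycle_vertices R \<Longrightarrow> \<Sum>S = T \<Longrightarrow> G \<subseteq> S"
  shows "min_decomp T R = G"
  unfolding min_decomp_def
proof (rule the_equality)
  show "G \<subseteq> cycle_vertices R \<and> \<Sum>G = T \<and> (\<forall>S. S \<subset> G \<longrightarrow> \<Sum>S \<noteq> T)"
    using assms by blast
  show "Q = G" if "Q \<subseteq> cycle_vertices R \<and> \<Sum>Q = T \<and> (\<forall>S. S \<subset> Q \<longrightarrow> \<Sum>S \<noteq> T)" for Q
    using that assms(2) least[of Q] by blast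
qed

lemma cycle_vertices_eq:
  fixes R :: "nat \<Rightarrow> real ^ 'n"
  assumes "symmetric_cycle R"
  shows "cycle_vertices R = R ` {..<CARD('n)} \<union> (\<lambda>k. - R k) ` {..<CARD('n)}"
proof -
  let ?t = "CARD('n)"
  have "{..<2 * ?t} = {..<?t} \<union> (\<lambda>k. k + ?t) ` {..<?t}"
  proof (intro equalityI subsetI)
    fix x assume "x \<in> {..<2 * ?t}"
    then have "x < ?t \<or> x = (x - ?t) + ?t \<and> x - ?t < ?t" by auto
    then show "x \<in> {..<?t} \<union> (\<lambda>k. k + ?t) ` {..<?t}" by blast
  qed auto
  then have "cycle_vertices R = R ` {..<?t} \<union> (\<lambda>k. R (k + ?t)) ` {..<?t}"
    by (simp add: cycle_vertices_def image_Un image_image)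
  also have "(\<lambda>k. R (k + ?t)) ` {..<?t} = (\<lambda>k. - R k) ` {..<?t}"
    using assms by (intro image_cong) (auto simp: symmetric_cycle_def)
  finally show ?thesis .
qed

lemma cycle_vertices_subset_hypercube:
  "symmetric_cycle R \<Longrightarrow> cycle_vertices R \<subseteq> hypercube"
  by (auto simp: symmetric_cycle_def cycle_vertices_def hypercube_adj_def)

lemma card_cycle_vertices:
  fixes R :: "nat \<Rightarrow> real ^ 'n"
  shows "symmetric_cycle R \<Longrightarrow> card (cycle_vertices R) = 2 * CARD('n)"
  by (auto simp: symmetric_cycle_def cycle_vertices_def card_image)

lemma finite_cycle_vertices: "finite (cycle_vertices R)"
  by (simp add: cycle_vertices_def)

text \<open>Since \<open>R t = - R 0\<close> is reached in \<open>t\<close> single flips, every coordinate is flipped exactly once.\<close>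

lemma symmetric_cycle_flip_order:
  fixes R :: "nat \<Rightarrow> real ^ 'n"
  assumes "symmetric_cycle R"
  obtains e where "bij_betw e {..<CARD('n)} UNIV"
    and "\<And>k. k \<le> CARD('n) \<Longrightarrow> R k = flips (R 0) (e ` {..<k})"
proof -
  let ?t = "CARD('n)"
  have pos: "?t > 0" by simp
  have adj: "hypercube_adj (R k) (R (Suc k))" if "k < ?t" for k
  proof -
    \<comment> \<open>In the first half of the cycle the index does not wrap around, so the
      \<open>mod\<close> disappears.\<close>
    have "Suc k < 2 * ?t" using that pos by linarith
    then show ?thesis
      using assms unfolding symmetric_cycle_def
      by (metis Suc_lessD mod_less)
  qed
  have "\<exists>i. {j. R (Suc k) $ j \<noteq> R k $ j} = {i}" if "k < ?t" for k
  proof -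
    have "hdist (R (Suc k)) (R k) = Suc 0"
      using adj[OF that] by (simp add: hypercube_adj_def hdist_commute)
    then show ?thesis
      unfolding hdist_def card_1_singleton_iff .
  qed
  then obtain e where e: "\<And>k. k < ?t \<Longrightarrow> {j. R (Suc k) $ j \<noteq> R k $ j} = {e k}"
    by metis
  have step: "R (Suc k) = flips (R k) {e k}" if "k < ?t" for k
    using flips_differing[of "R k" "R (Suc k)"] e[OF that] adj[OF that]
    by (simp add: hypercube_adj_def)
  have R0: "R 0 \<in> hypercube"
    using adj[OF pos] by (simp add: hypercube_adj_def)
  have same: "R k $ i = R 0 $ i" if "k \<le> ?t" "i \<notin> e ` {..<k}" for k i
    using that
  proof (induction k)
    case (Suc k)
    then show ?case by (auto simp: step lessThan_Suc)
  qed simp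
  have Rt: "R ?t = - R 0"
    using assms pos unfolding symmetric_cycle_def by (metis add_0)
  have "i \<in> e ` {..<?t}" for i
  proof (rule ccontr)
    assume "i \<notin> e ` {..<?t}"
    then have "- R 0 $ i = R 0 $ i"
      using same[of ?t i] Rt by simp
    then show False
      using hypercube_nth_cases[OF R0, of i] by auto
  qed
  then have surj: "e ` {..<?t} = UNIV" by auto
  \<comment> \<open>A surjection from \<open>t\<close> indices onto \<open>t\<close> coordinates is
    injective.\<close>
  have inj: "inj_on e {..<?t}"
    by (rule eq_card_imp_inj_on) (auto simp: surj)
  have eq: "R k = flips (R 0) (e ` {..<k})" if "k \<le> ?t" for k
    using that
  proof (induction k)
    case (Suc k)
    \<comment> \<open>A repeated coordinate would be flipped back; a new one just enlarges the flip
      set.\<close>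
    have "e k \<notin> e ` {..<k}"
      using inj Suc.prems by (auto dest: inj_onD)
    then show ?case
      using Suc step[of k] by (auto simp: vec_eq_iff lessThan_Suc)
  qed (simp add: vec_eq_iff)
  have "bij_betw e {..<?t} UNIV"
    using inj surj by (simp add: bij_betw_def)
  then show thesis
    using eq by (rule that)
qed

section \<open>Decompositions from a dual basis\<close>

lemma eq_or_eq_minus_trans:
  fixes a b v :: "'a::group_add"
  assumes "v = a \<or> v = - a" "v = b \<or> v = - b"
  shows "a = b \<or> a = - b"
  using assms by (metis minus_minus)

text \<open>Applied to the sum of a set \<open>S\<close> of cycle vertices, \<open>c k\<close>
  counts \<open>R k\<close> positively and \<open>- R k\<close> negatively. The value 1 therefore
  forces \<open>R k\<close> into \<open>S\<close> and the value -1 forces \<open>- R k\<close>, so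
  the displayed set lies in every \<open>S\<close> with sum \<open>T\<close>. Its own sum is
  \<open>T\<close> because the functionals separate vectors.\<close>

lemma min_decomp_dual_basis:
  fixes R :: "nat \<Rightarrow> real ^ 'n" and c :: "nat \<Rightarrow> real ^ 'n \<Rightarrow> real"
  assumes cyc: "symmetric_cycle R"
    and lin: "\<And>k. linear (c k)"
    and dual: "\<And>k m. k < CARD('n) \<Longrightarrow> m < CARD('n) \<Longrightarrow> c k (R m) = (if k = m then 1 else 0)"
    and separating: "\<And>V. (\<And>k. k < CARD('n) \<Longrightarrow> c k V = 0) \<Longrightarrow> V = 0"
    and range: "\<And>k. k < CARD('n) \<Longrightarrow> c k T \<in> {-1, 0, 1}"
  shows "min_decomp T R =
    {v \<in> cycle_vertices R. \<exists>k<CARD('n). v = R k \<and> c k T = 1 \<or> v = - R k \<and> c k T = -1}"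
proof -
  let ?t = "CARD('n)"
  define G where
    "G = {v \<in> cycle_vertices R. \<exists>k<?t. v = R k \<and> c k T = 1 \<or> v = - R k \<and> c k T = -1}"
  have verts: "R k \<in> cycle_vertices R" "- R k \<in> cycle_vertices R" if "k < ?t" for k
    using that cycle_vertices_eq[OF cyc] by auto
  have c_minus: "c k (- V) = - c k V" for k V
    using linear_neg[OF lin] .
  have ne: "R k \<noteq> - R m" if "k < ?t" "m < ?t" for k m
  proof
    assume "R k = - R m"
    then have "c k (R k) = - c k (R m)" by (simp add: c_minus)
    then show False using dual that by (auto split: if_splits)
  qed
  have inj: "R k = R m \<longleftrightarrow> k = m" if "k < ?t" "m < ?t" for k m
    using dual[of k m] dual[of k k] that by (auto split: if_splits)
  have c_vert: "c k v = of_bool (v = R k) - of_bool (v = - R k)"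
    if k: "k < ?t" and v: "v \<in> cycle_vertices R" for k v
  proof -
    obtain m where m: "m < ?t" "v = R m \<or> v = - R m"
      using v cycle_vertices_eq[OF cyc] by auto
    then show ?thesis
      using dual[OF k m(1)] c_minus inj[OF k m(1)] inj[OF m(1) k] ne[OF k m(1)] ne[OF m(1) k]
      by (auto split: if_splits)
  qed
  have c_sum: "c k (\<Sum>S) = of_bool (R k \<in> S) - of_bool (- R k \<in> S)"
    if k: "k < ?t" and S: "S \<subseteq> cycle_vertices R" for k S
  proof -
    have fin: "finite S"
      using S finite_cycle_vertices finite_subset by blast
    have "c k (\<Sum>S) = (\<Sum>v\<in>S. c k v)"
      using linear_sum[OF lin, of k "\<lambda>v. v" S] by simp
    also have "\<dots> = (\<Sum>v\<in>S. of_bool (v = R k) - of_bool (v = - R k))"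
      using S k by (intro sum.cong) (auto simp: c_vert subset_iff)
    also have "\<dots> = of_bool (R k \<in> S) - of_bool (- R k \<in> S)"
      using fin by (simp add: sum_subtractf of_bool_def)
    finally show ?thesis .
  qed
  have G: "R k \<in> G \<longleftrightarrow> c k T = 1" "- R k \<in> G \<longleftrightarrow> c k T = -1" if "k < ?t" for k
  proof -
    have "- R k \<noteq> R m" if "m < ?t" for m
      using ne[OF that \<open>k < ?t\<close>] by metis
    then show "R k \<in> G \<longleftrightarrow> c k T = 1" "- R k \<in> G \<longleftrightarrow> c k T = -1"
      using that verts[OF that] ne[OF that] inj[OF that] by (auto simp: G_def)
  qed
  have "min_decomp T R = G"
  proof (rule min_decomp_eqI)
    show sub: "G \<subseteq> cycle_vertices R" by (auto simp: G_def)
    have "c k (\<Sum>G - T) = 0" if "k < ?t" for k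
    proof -
      have "c k (\<Sum>G) = c k T"
        unfolding c_sum[OF that sub] G[OF that] using range[OF that] by auto
      then show ?thesis by (simp add: linear_diff[OF lin])
    qed
    then have "\<Sum>G - T = 0" by (rule separating)
    then show "\<Sum>G = T" by simp
    fix S assume S: "S \<subseteq> cycle_vertices R" "\<Sum>S = T"
    show "G \<subseteq> S"
    proof
      fix v assume "v \<in> G"
      then obtain k where k: "k < ?t" and v: "v = R k \<and> c k T = 1 \<or> v = - R k \<and> c k T = -1"
        by (auto simp: G_def)
      have "c k T = of_bool (R k \<in> S) - of_bool (- R k \<in> S)"
        using c_sum[OF k S(1)] S(2) by simp
      with v show "v \<in> S"
        by (auto simp: of_bool_def split: if_splits)
    qed
  qed
  then show ?thesis by (simp add: G_def)
qed

text \<open>The two coordinates attached to a vertex are the ones flipped by its two cycle edges.\<close>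

lemma min_decomp_agreement:
  fixes R :: "nat \<Rightarrow> real ^ 'n"
  assumes cyc: "symmetric_cycle R" and t2: "CARD('n) \<ge> 2"
  shows "\<exists>D. (\<forall>v\<in>cycle_vertices R. card (D v) = 2) \<and>
    (\<forall>T\<in>hypercube. min_decomp T R = {v \<in> cycle_vertices R. \<forall>i\<in>D v. T $ i = v $ i})"
proof -
  let ?t = "CARD('n)"
  obtain e where e: "bij_betw e {..<?t} UNIV"
    and R: "\<And>k. k \<le> ?t \<Longrightarrow> R k = flips (R 0) (e ` {..<k})"
    using symmetric_cycle_flip_order[OF cyc] by blast
  have inj: "e k = e m \<longleftrightarrow> k = m" if "k < ?t" "m < ?t" for k m
    using e that by (auto simp: bij_betw_def inj_on_def)
  have Re: "R k $ e m = (if m < k then - R 0 $ e m else R 0 $ e m)" if "k < ?t" "m < ?t" for k m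
  proof -
    have "e m \<in> e ` {..<k} \<longleftrightarrow> m < k"
      using inj that by fastforce
    then show ?thesis
      using R[of k] that by simp
  qed
  \<comment> \<open>Cyclic predecessor. The edge entering \<open>R 0\<close> comes from
    \<open>- R (t - 1)\<close> and flips the same coordinate as the antipodal edge from
    \<open>R (t - 1)\<close> to \<open>R t\<close>, namely \<open>e (t - 1)\<close>. For
    \<open>t = 1\<close> the index 0 would be its own predecessor.\<close>
  define p where "p k = (if k = 0 then ?t - 1 else k - 1)" for k
  have p: "p k < ?t" "p k \<noteq> k" if "k < ?t" for k
    using that t2 by (auto simp: p_def)
  have hyp: "R k \<in> hypercube" if "k < ?t" for k
    using that cycle_vertices_eq[OF cyc] cycle_vertices_subset_hypercube[OF cyc] by auto
  have sq: "R k $ i * R k $ i = 1" if "k < ?t" for k i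
    using hypercube_nth_cases[OF hyp[OF that], of i] by auto
  define c where "c k V = (V $ e k * R k $ e k + V $ e (p k) * R k $ e (p k)) / 2"
    for k and V :: "real ^ 'n"
  have lin: "linear (c k)" for k
    unfolding c_def by (rule linearI) (auto simp: algebra_simps add_divide_distrib)
  have dual: "c k (R m) = (if k = m then 1 else 0)" if "k < ?t" "m < ?t" for k m
  proof -
    have agree: "R m $ e j * R k $ e j = (if (j < m) = (j < k) then 1 else - 1)" if "j < ?t" for j
      unfolding Re[OF \<open>m < ?t\<close> that] Re[OF \<open>k < ?t\<close> that] using sq[of 0 "e j"] by simp
    \<comment> \<open>\<open>R m\<close> and \<open>R k\<close> agree at \<open>e k\<close> iff
      \<open>m \<le> k\<close> and at \<open>e (p k)\<close> iff \<open>k \<le> m\<close>; the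
      latter always holds for \<open>k = 0\<close>. Unless \<open>k = m\<close>, exactly one
      agreement fails and the two products cancel.\<close>
    have "(p k < m) = (p k < k) \<longleftrightarrow> k = m \<or> k < m"
      using that by (cases k) (auto simp: p_def)
    then show ?thesis
      unfolding c_def agree[OF that(1)] agree[OF p(1)[OF that(1)]] by auto
  qed
  have sep: "V = 0" if V: "\<And>k. k < ?t \<Longrightarrow> c k V = 0" for V
  proof -
    \<comment> \<open>In these rescaled coordinates \<open>c (Suc k)\<close> is half a difference of
      neighbours, so \<open>s\<close> is constant. The sign change around the cycle makes
      \<open>c 0\<close> half the sum of the first and last values, so the constant is 0.\<close>
    define s where "s m = V $ e m * R 0 $ e m" for m
    have const: "s k = s 0" if "k < ?t" for k
      using that
    proof (induction k)
      case (Suc k)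
      then have "k < ?t" by simp
      have "c (Suc k) V = (s (Suc k) - s k) / 2"
        by (simp add: c_def p_def s_def Re[OF Suc.prems Suc.prems] Re[OF Suc.prems \<open>k < ?t\<close>])
      then show ?case
        using V[OF Suc.prems] Suc.IH[OF \<open>k < ?t\<close>] by simp
    qed simp
    have "c 0 V = (s 0 + s (?t - 1)) / 2"
      by (simp add: c_def p_def s_def)
    then have "s 0 + s (?t - 1) = 0"
      using V[of 0] by simp
    moreover have "s (?t - 1) = s 0"
      by (rule const) simp
    ultimately have s0: "s 0 = 0"
      by linarith
    have "V $ i = 0" for i
    proof -
      have "i \<in> e ` {..<?t}"
        using bij_betw_imp_surj_on[OF e] by simp
      then obtain k where k: "k < ?t" "i = e k" by blast
      have "V $ e k * R 0 $ e k = 0"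
        using const[OF k(1)] s0 by (simp add: s_def)
      then show "V $ i = 0"
        using sq[of 0 "e k"] k(2) by auto
    qed
    then show "V = 0"
      by (simp add: vec_eq_iff)
  qed
  have range: "c k T \<in> {-1, 0, 1}"
    and one: "c k T = 1 \<longleftrightarrow> T $ e k = R k $ e k \<and> T $ e (p k) = R k $ e (p k)"
    and minus_one: "c k T = -1 \<longleftrightarrow> T $ e k = - R k $ e k \<and> T $ e (p k) = - R k $ e (p k)"
    if "k < ?t" "T \<in> hypercube" for k T
    unfolding c_def
    using hypercube_nth_cases[OF hyp[OF that(1)], of "e k"]
      hypercube_nth_cases[OF hyp[OF that(1)], of "e (p k)"]
      hypercube_nth_cases[OF that(2), of "e k"] hypercube_nth_cases[OF that(2), of "e (p k)"]
    by auto
  \<comment> \<open>The index is recovered from the vertex by choice; \<open>uniq\<close> below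
    makes it unambiguous. Antipodal vertices receive the same pair.\<close>
  define D where "D v = (let k = (SOME k. k < ?t \<and> (v = R k \<or> v = - R k)) in {e k, e (p k)})" for v
  have uniq: "m = k" if "k < ?t" "m < ?t" "R k = R m \<or> R k = - R m" for k m
  proof (rule ccontr)
    assume "m \<noteq> k"
    then have "c k (R m) = 0" "c k (- R m) = 0"
      using dual[OF that(1,2)] linear_neg[OF lin, of k "R m"] by auto
    then have "c k (R k) = 0"
      using that(3) by metis
    then show False
      using dual[OF that(1,1)] by simp
  qed
  have D: "D v = {e k, e (p k)}" if k: "k < ?t" "v = R k \<or> v = - R k" for v k
  proof -
    have "(SOME k. k < ?t \<and> (v = R k \<or> v = - R k)) = k"
    proof (rule some_equality)
      show "m = k" if "m < ?t \<and> (v = R m \<or> v = - R m)" for m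
        using uniq[OF k(1) _ eq_or_eq_minus_trans[OF k(2)]] that by blast
    qed (use k in simp)
    then show ?thesis by (simp add: D_def)
  qed
  show ?thesis
  proof (intro exI[of _ D] conjI ballI)
    fix v assume "v \<in> cycle_vertices R"
    then obtain k where "k < ?t" "v = R k \<or> v = - R k"
      unfolding cycle_vertices_eq[OF cyc] by blast
    moreover from this have "e k \<noteq> e (p k)"
      using p[of k] inj[of k "p k"] by metis
    ultimately show "card (D v) = 2"
      using D[of k v] by simp
  next
    fix T :: "real ^ 'n" assume T: "T \<in> hypercube"
    have agreement: "(\<exists>k<?t. v = R k \<and> c k T = 1 \<or> v = - R k \<and> c k T = -1) \<longleftrightarrow>
        (\<forall>i\<in>D v. T $ i = v $ i)"
      if v: "v \<in> cycle_vertices R" for v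
    proof -
      obtain k where k: "k < ?t" "v = R k \<or> v = - R k"
        using v unfolding cycle_vertices_eq[OF cyc] by blast
      have "c k (R k) \<noteq> c k (- R k)"
        using dual[OF k(1) k(1)] linear_neg[OF lin, of k "R k"] by simp
      then have neq: "R k \<noteq> - R k"
        by metis
      have "m = k" if "m < ?t" "v = R m \<or> v = - R m" for m
        using that by (rule uniq[OF k(1) _ eq_or_eq_minus_trans[OF k(2)]])
      then have "(\<exists>k<?t. v = R k \<and> c k T = 1 \<or> v = - R k \<and> c k T = -1) \<longleftrightarrow>
          (v = R k \<and> c k T = 1 \<or> v = - R k \<and> c k T = -1)"
        using k(1) by blast
      also have "\<dots> \<longleftrightarrow> T $ e k = v $ e k \<and> T $ e (p k) = v $ e (p k)"
        using k(2)
      proof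
        assume "v = R k"
        then show ?thesis using neq one[OF k(1) T] by simp
      next
        assume "v = - R k"
        then show ?thesis using neq[symmetric] minus_one[OF k(1) T] by simp
      qed
      also have "\<dots> \<longleftrightarrow> (\<forall>i\<in>D v. T $ i = v $ i)"
        by (simp add: D[OF k])
      finally show ?thesis .
    qed
    have "min_decomp T R =
        {v \<in> cycle_vertices R. \<exists>k<?t. v = R k \<and> c k T = 1 \<or> v = - R k \<and> c k T = -1}"
      by (rule min_decomp_dual_basis[OF cyc lin]) (fact dual, fact sep, rule range[OF _ T])
    also have "\<dots> = {v \<in> cycle_vertices R. \<forall>i\<in>D v. T $ i = v $ i}"
      using agreement by blast
    finally show "min_decomp T R = {v \<in> cycle_vertices R. \<forall>i\<in>D v. T $ i = v $ i}" .
  qed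
qed

section \<open>Double counting over cycle vertices\<close>

theorem mainTheorem5:
  fixes R :: "nat \<Rightarrow> real ^ 'n" and t :: nat
  assumes "t = CARD('n)" and "t \<ge> 2" and "symmetric_cycle R"
  shows
    "(real (\<Sum>T\<in>hypercube. card (min_decomp T R)) =
       real t / 2 * (\<Sum>(i, j) | 1 \<le> i \<and> i \<le> t \<and> j \<le> t \<and> int j \<in> {int i - 2, int i + 2}.
         real (intersection_number TYPE('n) 2 i j) * real i * (real i - real j))) \<and>
     (real (\<Sum>T\<in>hypercube. card (min_decomp T R)) =
       real t / 2 * (\<Sum>(i, j) | 1 \<le> i \<and> i \<le> t \<and> j \<le> t \<and> int j \<in> {int i - 2, int i + 2}.
         real ((t - 2) choose ((i + j) div 2 - 1)) * real i * (real i - real j))) \<and>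
     ((\<Sum>T\<in>hypercube. card (min_decomp T R)) = 2 ^ (t - 1) * t) \<and>
     (card (hypercube_edges :: (real ^ 'n) set set) = 2 ^ (t - 1) * t) \<and>
     ((\<Sum>T\<in>hypercube. \<Sum>Q\<in>min_decomp T R. hdist T Q) = 2 ^ (t - 2) * (t - 2) * t)"
proof -
  obtain D where D: "\<forall>v\<in>cycle_vertices R. card (D v) = 2"
    and dec: "\<forall>T\<in>hypercube. min_decomp T R = {v \<in> cycle_vertices R. \<forall>i\<in>D v. T $ i = v $ i}"
    using min_decomp_agreement[OF assms(3) assms(2)[unfolded assms(1)]] by blast
  have swap: "(\<Sum>T\<in>hypercube. \<Sum>v\<in>min_decomp T R. f T v) =
      (\<Sum>v\<in>cycle_vertices R. \<Sum>T | T \<in> hypercube \<and> (\<forall>i\<in>D v. T $ i = v $ i). f T v)"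
    for f :: "real ^ 'n \<Rightarrow> real ^ 'n \<Rightarrow> nat"
  proof -
    have "(\<Sum>T\<in>hypercube. \<Sum>v\<in>min_decomp T R. f T v) =
        (\<Sum>T\<in>hypercube. \<Sum>v | v \<in> cycle_vertices R \<and> (\<forall>i\<in>D v. T $ i = v $ i). f T v)"
      by (intro sum.cong) (auto simp: dec)
    also have "\<dots> = (\<Sum>v\<in>cycle_vertices R. \<Sum>T | T \<in> hypercube \<and> (\<forall>i\<in>D v. T $ i = v $ i). f T v)"
      by (rule sum.swap_restrict[OF finite_hypercube finite_cycle_vertices])
    finally show ?thesis .
  qed
  have cube: "v \<in> hypercube" if "v \<in> cycle_vertices R" for v
    using that cycle_vertices_subset_hypercube[OF assms(3)] by auto
  \<comment> \<open>Removes truncated subtraction from the exponents.\<close>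
  obtain s where s: "t = Suc (Suc s)"
    using assms(2) by (metis add_2_eq_Suc le_Suc_ex)
  have pow1: "2 * 2 ^ (t - 2) = (2 :: nat) ^ (t - 1)"
    by (simp add: s)
  have "(\<Sum>T\<in>hypercube. card (min_decomp T R)) =
      (\<Sum>v\<in>cycle_vertices R. card {T \<in> hypercube. \<forall>i\<in>D v. T $ i = v $ i})"
    using swap[of "\<lambda>_ _. 1"] by simp
  also have "\<dots> = (\<Sum>v\<in>cycle_vertices R. 2 ^ (t - 2))"
    by (intro sum.cong refl) (simp add: card_hypercube_agreeing[OF cube] D assms(1))
  also have "\<dots> = 2 ^ (t - 1) * t"
    using pow1 by (simp add: card_cycle_vertices[OF assms(3)] assms(1)[symmetric])
  finally have count: "(\<Sum>T\<in>hypercube. card (min_decomp T R)) = 2 ^ (t - 1) * t" .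
  \<comment> \<open>The doubled sum matches \<open>sum_hdist_agreeing\<close>; the factor is
    cancelled at the end.\<close>
  have "2 * (\<Sum>T\<in>hypercube. \<Sum>Q\<in>min_decomp T R. hdist T Q) =
      (\<Sum>v\<in>cycle_vertices R. (t - 2) * 2 ^ (t - 2))"
    unfolding swap sum_distrib_left[of 2 _ "cycle_vertices R"]
    by (intro sum.cong refl) (simp add: sum_hdist_agreeing[OF cube] D assms(1))
  also have "\<dots> = 2 * (2 ^ (t - 2) * (t - 2) * t)"
    by (simp add: card_cycle_vertices[OF assms(3)] assms(1)[symmetric])
  finally have dist: "(\<Sum>T\<in>hypercube. \<Sum>Q\<in>min_decomp T R. hdist T Q) = 2 ^ (t - 2) * (t - 2) * t"
    by simp
  have halved: "real t / 2 * 2 ^ t = real (2 ^ (t - 1) * t)"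
    by (simp add: s algebra_simps)
  have "intersection_number TYPE('n) 2 m (m + 2) = (t - 2) choose m" for m
    unfolding assms(1) by (rule intersection_number_plus) (use assms(1,2) in simp)
  moreover from this have "intersection_number TYPE('n) 2 (m + 2) m = (t - 2) choose m" for m
    using intersection_number_sym[where 'n = 'n] by metis
  ultimately have intersection:
    "(\<Sum>(i, j) | 1 \<le> i \<and> i \<le> t \<and> j \<le> t \<and> int j \<in> {int i - 2, int i + 2}.
         real (intersection_number TYPE('n) 2 i j) * real i * (real i - real j)) = 2 ^ t"
    using assms(2) by (intro sum_index_pairs_binomial) simp_all
  have binomial: "(\<Sum>(i, j) | 1 \<le> i \<and> i \<le> t \<and> j \<le> t \<and> int j \<in> {int i - 2, int i + 2}.
         real ((t - 2) choose ((i + j) div 2 - 1)) * real i * (real i - real j)) = 2 ^ t"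
    \<comment> \<open>For indices \<open>m\<close> and \<open>m + 2\<close> in either order,
      \<open>(i + j) div 2 - 1\<close> equals \<open>m\<close>.\<close>
    using assms(2) by (intro sum_index_pairs_binomial) auto
  have edges: "card (hypercube_edges :: (real ^ 'n) set set) = 2 ^ (t - 1) * t"
    unfolding assms(1) by (rule card_hypercube_edges)
  show ?thesis
    unfolding count dist intersection binomial edges by (intro conjI refl halved[symmetric])
qed

end
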